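(* Let $G$ be a finite abelian group, written multiplicatively, with identity $e$ and exponent $N$, and let $S\subseteq G\setminus\{e\}$. Let $C_N$ be the group of complex $N$-th roots of unity. Define $\phi$ on the arcs of the Cayley digraph $\mathrm{Cay}(G;S)$ by $\phi((g,gs))=\exp\!\left(\frac{2\pi i}{\mathrm{ord}(s)}\right)\in C_N$. Then $S$ is weakly half factorial if and only if the voltage digraph $(\mathrm{Cay}(G;S),\phi,C_N)$ satisfies Kirchhoff's Voltage Law.
   Context: Blocks and atoms: a finite sequence (multiset) $\{g_1,\dots,g_k\}$ of non-identity elements of $G$ is a block if $\prod_{i=1}^k g_i=e$. It is an atom if, whenever $\prod_{i=1}^k g_i^{m_i}=e$ with all $m_i\in\{0,1\}$, either all $m_i=1$ or all $m_i=0$. An atom has support in $S$ if all its $g_i$ lie in $S$. Cross number: the cross number of $\beta=\{g_1,\dots,g_k\}$ is $c(\beta)=\sum_{i=1}^k 1/\mathrm{ord}(g_i)$, where $\mathrm{ord}(g)$ is the order of $g$ in $G$ and elements are counted with multiplicity. Weakly half factorial (property $(C_0)$): $S$ is weakly half factorial if every atom with support in $S$ has an integer cross number. Cayley digraph: $\mathrm{Cay}(G;S)$ has vertex set $G$ and arc set $\{(g,gs): g\in G,\ s\in S\}$. Paths: a walk is a sequence of arcs $a_1\cdots a_k$ with $k\ge 1$ such that the end vertex of $a_i$ is the start vertex of $a_{i+1}$. A path is a walk whose vertices $x_1,\dots,x_{k+1}$ are distinct, except that $x_1=x_{k+1}$ is allowed. A closed path is a path with $x_1=x_{k+1}$. Kirchhoff's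 Voltage Law: the voltage digraph satisfies Kirchhoff's Voltage Law if every closed path $a_1a_2\cdots a_k$ satisfies $\prod_{i=1}^k\phi(a_i)=1$. *)

theory Defs
  imports
    "HOL-Algebra.Multiplicative_Group"
    "HOL-Analysis.Complex_Transcendental"
    "Graph_Theory.Arc_Walk"
begin

text \<open>
  A finite multiset of group elements is represented by a list enumerating it; none of the
  notions below depends on the order of the enumeration when the group is commutative.
\<close>

definition is_block :: "('a, 'b) monoid_scheme \<Rightarrow> 'a list \<Rightarrow> bool" where
  "is_block G gs \<longleftrightarrow> set gs \<subseteq> carrier G - {\<one>\<^bsub>G\<^esub>} \<and>
     (\<Otimes>\<^bsub>G\<^esub>i\<in>{..<length gs}. gs ! i) = \<one>\<^bsub>G\<^esub>"

definition is_atom :: "('a, 'b) monoid_scheme \<Rightarrow> 'a list \<Rightarrow> bool" where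
  "is_atom G gs \<longleftrightarrow> is_block G gs \<and>
     (\<forall>m :: nat \<Rightarrow> nat.
        (\<forall>i<length gs. m i \<in> {0, 1}) \<longrightarrow>
        (\<Otimes>\<^bsub>G\<^esub>i\<in>{..<length gs}. (gs ! i) [^]\<^bsub>G\<^esub> m i) = \<one>\<^bsub>G\<^esub> \<longrightarrow>
        (\<forall>i<length gs. m i = 1) \<or> (\<forall>i<length gs. m i = 0))"

definition cross_number :: "('a, 'b) monoid_scheme \<Rightarrow> 'a list \<Rightarrow> real" where
  "cross_number G gs = (\<Sum>i<length gs. 1 / real (group.ord G (gs ! i)))"

definition weakly_half_factorial :: "('a, 'b) monoid_scheme \<Rightarrow> 'a set \<Rightarrow> bool" where
  "weakly_half_factorial G S \<longleftrightarrow>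
     (\<forall>gs. is_atom G gs \<and> set gs \<subseteq> S \<longrightarrow> cross_number G gs \<in> \<int>)"

definition cayley_digraph ::
    "('a, 'b) monoid_scheme \<Rightarrow> 'a set \<Rightarrow> ('a, 'a \<times> 'a) pre_digraph" where
  "cayley_digraph G S =
     \<lparr>verts = carrier G,
      arcs = {(g, g \<otimes>\<^bsub>G\<^esub> s) | g s. g \<in> carrier G \<and> s \<in> S},
      tail = fst,
      head = snd\<rparr>"

definition group_exponent :: "('a, 'b) monoid_scheme \<Rightarrow> nat" where
  "group_exponent G = (LEAST n. 0 < n \<and> (\<forall>x\<in>carrier G. x [^]\<^bsub>G\<^esub> n = \<one>\<^bsub>G\<^esub>))"

definition roots_of_unity_group :: "nat \<Rightarrow> complex monoid" where
  "roots_of_unity_group n = \<lparr>carrier = {z. z ^ n = 1}, monoid.mult = (*), one = 1\<rparr>"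

definition voltage_digraph ::
    "('v, 'e) pre_digraph \<Rightarrow> ('e \<Rightarrow> 'h) \<Rightarrow> ('h, 'b) monoid_scheme \<Rightarrow> bool" where
  "voltage_digraph D \<phi> H \<longleftrightarrow> wf_digraph D \<and> group H \<and> \<phi> \<in> arcs D \<rightarrow> carrier H"

text \<open>
  \<^const>\<open>pre_digraph.cycle\<close> is the notion of a closed path: a nonempty walk that returns to its
  start and is otherwise without repeated vertices. Loops and closed paths with two arcs are
  included.
\<close>

lemma cycle_iff_closed_path:
  "pre_digraph.cycle D p \<longleftrightarrow>
     p \<noteq> [] \<and>
     (\<exists>u. pre_digraph.awalk D u p u \<and>
       (\<forall>i j. i < j \<and> j \<le> length p \<and>
          pre_digraph.awalk_verts D u p ! i = pre_digraph.awalk_verts D u p ! j \<longrightarrow>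
          i = 0 \<and> j = length p))"
proof -
  have tl_distinct: "distinct (tl xs) \<longleftrightarrow>
      (\<forall>i j. i < j \<and> j \<le> length p \<and> xs ! i = xs ! j \<longrightarrow> i = 0 \<and> j = length p)"
    if len: "length xs = Suc (length p)" and eq: "xs ! 0 = xs ! length p" and ne: "p \<noteq> []"
    for xs :: "'a list"
  proof
    assume d: "distinct (tl xs)"
    have inj: "a = b" if "0 < a" "0 < b" "a \<le> length p" "b \<le> length p" "xs ! a = xs ! b" for a b
    proof -
      have "tl xs ! (a - 1) = tl xs ! (b - 1)"
        using that len by (simp add: nth_tl)
      then have "a - 1 = b - 1"
        using that len d by (subst (asm) nth_eq_iff_index_eq) auto
      with that show ?thesis by simp
    qed
    show "\<forall>i j. i < j \<and> j \<le> length p \<and> xs ! i = xs ! j \<longrightarrow> i = 0 \<and> j = length p"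
    proof (intro allI impI, elim conjE)
      fix i j assume ij: "i < j" "j \<le> length p" "xs ! i = xs ! j"
      have "i = 0" using inj[of i j] ij by (cases "i = 0") auto
      moreover have "j = length p" using inj[of j "length p"] ij eq ne \<open>i = 0\<close> by auto
      ultimately show "i = 0 \<and> j = length p" ..
    qed
  next
    assume r: "\<forall>i j. i < j \<and> j \<le> length p \<and> xs ! i = xs ! j \<longrightarrow> i = 0 \<and> j = length p"
    have "xs ! Suc a \<noteq> xs ! Suc b" if "a < b" "b < length p" for a b
      using r[rule_format, of "Suc a" "Suc b"] that by auto
    then have "a = b" if "a < length p" "b < length p" "xs ! Suc a = xs ! Suc b" for a b
      using that by (metis nat_neq_iff)
    then show "distinct (tl xs)"
      using len by (auto simp: distinct_conv_nth nth_tl)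
  qed
  have last: "v = head D (last q)" if "pre_digraph.cas D w q v" "q \<noteq> []" for w v q
    using that by (induction q arbitrary: w)
      (auto simp: pre_digraph.cas.simps split: if_splits)
  have "distinct (tl (pre_digraph.awalk_verts D u p)) \<longleftrightarrow>
      (\<forall>i j. i < j \<and> j \<le> length p \<and>
        pre_digraph.awalk_verts D u p ! i = pre_digraph.awalk_verts D u p ! j \<longrightarrow>
        i = 0 \<and> j = length p)"
    if walk: "pre_digraph.awalk D u p u" and ne: "p \<noteq> []" for u
  proof (rule tl_distinct)
    show "length (pre_digraph.awalk_verts D u p) = Suc (length p)"
      by (rule pre_digraph.length_awalk_verts)
    have cas: "pre_digraph.cas D u p u"
      using walk by (simp add: pre_digraph.awalk_def)
    have "pre_digraph.awalk_verts D u p ! length p = u"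
      using last[OF cas ne] ne by (simp add: pre_digraph.awalk_verts_conv nth_append)
    moreover have "pre_digraph.awalk_verts D u p ! 0 = u"
      using cas ne by (cases p) (simp_all add: pre_digraph.cas.simps pre_digraph.awalk_verts.simps)
    ultimately show "pre_digraph.awalk_verts D u p ! 0 = pre_digraph.awalk_verts D u p ! length p"
      by simp
  qed (fact ne)
  then show ?thesis
    unfolding pre_digraph.cycle_def by blast
qed

definition kirchhoff_voltage_law ::
    "('v, 'e) pre_digraph \<Rightarrow> ('e \<Rightarrow> 'h) \<Rightarrow> ('h, 'b) monoid_scheme \<Rightarrow> bool" where
  "kirchhoff_voltage_law D \<phi> H \<longleftrightarrow>
     (\<forall>p. pre_digraph.cycle D p \<longrightarrow> foldr (\<otimes>\<^bsub>H\<^esub>) (map \<phi> p) \<one>\<^bsub>H\<^esub> = \<one>\<^bsub>H\<^esub>)"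

text \<open>
  An arc \<open>(g, h)\<close> of the Cayley digraph determines the generator \<open>s = g\<inverse> h\<close> it comes from.
\<close>

definition cayley_voltage :: "('a, 'b) monoid_scheme \<Rightarrow> 'a \<times> 'a \<Rightarrow> complex" where
  "cayley_voltage G =
     (\<lambda>(g, h). exp (2 * of_real pi * \<i> / of_nat (group.ord G (inv\<^bsub>G\<^esub> g \<otimes>\<^bsub>G\<^esub> h))))"

lemma cayley_voltage_arc:
  assumes "group G" "g \<in> carrier G" "s \<in> carrier G"
  shows "cayley_voltage G (g, g \<otimes>\<^bsub>G\<^esub> s) = exp (2 * of_real pi * \<i> / of_nat (group.ord G s))"
proof -
  interpret group G by fact
  have "inv\<^bsub>G\<^esub> g \<otimes>\<^bsub>G\<^esub> (g \<otimes>\<^bsub>G\<^esub> s) = s"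
    using assms by (simp flip: m_assoc)
  then show ?thesis by (simp add: cayley_voltage_def)
qed

lemma group_exponent:
  assumes "group G" "finite (carrier G)"
  shows "0 < group_exponent G" "x \<in> carrier G \<Longrightarrow> x [^]\<^bsub>G\<^esub> group_exponent G = \<one>\<^bsub>G\<^esub>"
proof -
  interpret group G by fact
  have "0 < order G \<and> (\<forall>x\<in>carrier G. x [^]\<^bsub>G\<^esub> order G = \<one>\<^bsub>G\<^esub>)"
    using assms pow_order_eq_1 by (simp add: order_gt_0_iff_finite)
  then have "0 < group_exponent G \<and> (\<forall>x\<in>carrier G. x [^]\<^bsub>G\<^esub> group_exponent G = \<one>\<^bsub>G\<^esub>)"
    unfolding group_exponent_def by (rule LeastI)
  then show "0 < group_exponent G"
    "x \<in> carrier G \<Longrightarrow> x [^]\<^bsub>G\<^esub> group_exponent G = \<one>\<^bsub>G\<^esub>" by auto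
qed

lemma group_roots_of_unity_group:
  assumes "0 < n"
  shows "group (roots_of_unity_group n)"
proof (rule groupI)
  fix z assume "z \<in> carrier (roots_of_unity_group n)"
  then have "z ^ n = 1" by (simp add: roots_of_unity_group_def)
  moreover from this assms have "z \<noteq> 0" by (auto simp: zero_power)
  ultimately show "\<exists>y\<in>carrier (roots_of_unity_group n).
      y \<otimes>\<^bsub>roots_of_unity_group n\<^esub> z = \<one>\<^bsub>roots_of_unity_group n\<^esub>"
    by (intro bexI[of _ "inverse z"]) (auto simp: roots_of_unity_group_def power_inverse)
qed (auto simp: roots_of_unity_group_def power_mult_distrib)

lemma voltage_digraph_cayley:
  assumes "group G" "finite (carrier G)" "S \<subseteq> carrier G"
  shows "voltage_digraph (cayley_digraph G S) (cayley_voltage G)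
           (roots_of_unity_group (group_exponent G))"
proof -
  interpret group G by fact
  have "wf_digraph (cayley_digraph G S)"
    using assms(3) by unfold_locales (auto simp: cayley_digraph_def)
  moreover have "cayley_voltage G (g, g \<otimes>\<^bsub>G\<^esub> s) ^ group_exponent G = 1"
    if "g \<in> carrier G" "s \<in> S" for g s
  proof -
    have s: "s \<in> carrier G" using that assms by auto
    have "ord s dvd group_exponent G"
      using group_exponent(2)[OF assms(1,2) s] s by (simp add: pow_eq_id)
    then obtain k where k: "group_exponent G = ord s * k" ..
    have "ord s \<noteq> 0" using ord_ge_1[OF assms(2) s] by simp
    then have "of_nat (group_exponent G) * (2 * of_real pi * \<i> / of_nat (ord s))
        = 2 * of_real pi * \<i> * (of_nat k :: complex)"
      by (simp add: k field_simps)
    moreover have "exp (2 * of_real pi * \<i> * of_nat k) = (1 :: complex)"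
      using exp_2pi_1_nat[of k] by (simp only: mult_ac)
    ultimately show ?thesis
      by (simp add: cayley_voltage_arc[OF assms(1) that(1) s] flip: exp_of_nat_mult)
  qed
  ultimately show ?thesis
    using group_roots_of_unity_group[OF group_exponent(1)[OF assms(1,2)]]
    by (auto simp: voltage_digraph_def cayley_digraph_def roots_of_unity_group_def)
qed

end

theory Submission
  imports Defs
begin

text \<open>
  A walk in the Cayley digraph is a start vertex together with the list of generators read along
  its arcs, and the product of its voltages is \<open>exp (2 \<pi> \<i> c)\<close>, where \<open>c\<close> is the cross number of that
  list. A closed path therefore yields a block, and every block splits into atoms, so that its cross
  number is an integer if \<open>S\<close> is weakly half factorial. Conversely, the partial products of an atom,
  taken in any order, are distinct apart from the first and the last, because two equal ones would
  enclose a proper sub-block; hence an atom is read along a closed path.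
\<close>

context comm_group
begin

section \<open>Atoms as minimal index sets and the decomposition of blocks\<close>

lemma finprod_binary_pow:
  fixes m :: "'i \<Rightarrow> nat"
  assumes "finite A" "f \<in> A \<rightarrow> carrier G" "\<And>i. i \<in> A \<Longrightarrow> m i \<in> {0, 1}"
  shows "(\<Otimes>i\<in>A. f i [^] m i) = (\<Otimes>i\<in>{i\<in>A. m i = 1}. f i)"
proof -
  have "(\<Otimes>i\<in>{i\<in>A. m i = 1}. f i) = (\<Otimes>i\<in>A. f i [^] m i)"
    using assms by (intro finprod_mono_neutral_cong_left) (force simp: Pi_iff)+
  then show ?thesis ..
qed

text \<open>A 0-1 exponent function is the indicator of the index set where it equals 1, so
  minimality becomes a condition on subsets of indices, the form used from here on. Only the last
  conjunct differs from the definition, and it is compared under \<open>?carr\<close>, which places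
  all factors in the carrier.\<close>

lemma is_atom_iff:
  "is_atom G gs \<longleftrightarrow> set gs \<subseteq> carrier G - {\<one>} \<and> (\<Otimes>i\<in>{..<length gs}. gs ! i) = \<one> \<and>
     (\<forall>J \<subseteq> {..<length gs}. (\<Otimes>i\<in>J. gs ! i) = \<one> \<longrightarrow> J = {} \<or> J = {..<length gs})"
  (is "_ \<longleftrightarrow> ?carr \<and> ?prod \<and> ?minimal")
proof -
  define n where "n = length gs"
  have "(\<forall>m::nat \<Rightarrow> nat. (\<forall>i<n. m i \<in> {0, 1}) \<longrightarrow> (\<Otimes>i\<in>{..<n}. (gs ! i) [^] m i) = \<one> \<longrightarrow>
          (\<forall>i<n. m i = 1) \<or> (\<forall>i<n. m i = 0)) \<longleftrightarrow>
        (\<forall>J \<subseteq> {..<n}. (\<Otimes>i\<in>J. gs ! i) = \<one> \<longrightarrow> J = {} \<or> J = {..<n})"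
    (is "?L \<longleftrightarrow> ?R") if "?carr"
  proof -
    have gs: "(\<lambda>i. gs ! i) \<in> {..<n} \<rightarrow> carrier G"
      using that nth_mem by (fastforce simp: n_def)
    show ?thesis
    proof
      assume L: ?L
      show ?R
      proof (intro allI impI)
        fix J assume J: "J \<subseteq> {..<n}" "(\<Otimes>i\<in>J. gs ! i) = \<one>"
        define m :: "nat \<Rightarrow> nat" where "m i = (if i \<in> J then 1 else 0)" for i
        have "{i\<in>{..<n}. m i = 1} = J" using J(1) by (auto simp: m_def)
        then have "(\<Otimes>i\<in>{..<n}. (gs ! i) [^] m i) = \<one>"
          using J(2) gs by (subst finprod_binary_pow) (auto simp: m_def)
        then have "(\<forall>i<n. m i = 1) \<or> (\<forall>i<n. m i = 0)"
          using L by (auto simp: m_def)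
        then show "J = {} \<or> J = {..<n}"
          using J(1) by (auto simp: m_def split: if_splits)
      qed
    next
      assume R: ?R
      show ?L
      proof (intro allI impI)
        fix m :: "nat \<Rightarrow> nat"
        assume m: "\<forall>i<n. m i \<in> {0, 1}" "(\<Otimes>i\<in>{..<n}. (gs ! i) [^] m i) = \<one>"
        have "(\<Otimes>i\<in>{i\<in>{..<n}. m i = 1}. gs ! i) = \<one>"
          using m gs by (subst (asm) finprod_binary_pow) auto
        then have "{i\<in>{..<n}. m i = 1} = {} \<or> {i\<in>{..<n}. m i = 1} = {..<n}"
          by (intro R[rule_format]) auto
        with m(1) show "(\<forall>i<n. m i = 1) \<or> (\<forall>i<n. m i = 0)"
          by auto
      qed
    qed
  qed
  then show ?thesis
    unfolding is_atom_def is_block_def n_def by meson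
qed

text \<open>Atoms are lists, while the induction on blocks below runs over finite index sets. An
  enumeration \<open>xs\<close> without repetition is a bijection from positions to indices, so
  minimality transfers; \<open>f\<close> itself may repeat values.\<close>

lemma is_atom_map:
  assumes "distinct xs" "f ` set xs \<subseteq> carrier G - {\<one>}" "(\<Otimes>x\<in>set xs. f x) = \<one>"
    and minimal: "\<And>J. J \<subset> set xs \<Longrightarrow> (\<Otimes>x\<in>J. f x) = \<one> \<Longrightarrow> J = {}"
  shows "is_atom G (map f xs)"
proof -
  have bij: "bij_betw ((!) xs) {..<length xs} (set xs)"
    using assms(1) by (auto intro: bij_betw_nth)
  have prod: "(\<Otimes>i\<in>J. map f xs ! i) = (\<Otimes>x\<in>(!) xs ` J. f x)" if "J \<subseteq> {..<length xs}" for J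
  proof -
    have "(\<Otimes>x\<in>(!) xs ` J. f x) = (\<Otimes>i\<in>J. f (xs ! i))"
      using that assms(2) bij
      by (intro finprod_reindex) (fastforce simp: bij_betw_def intro: inj_on_subset)+
    also have "\<dots> = (\<Otimes>i\<in>J. map f xs ! i)"
      using that assms(2) by (intro finprod_cong') (force simp: subset_iff)+
    finally show ?thesis ..
  qed
  have "J = {} \<or> J = {..<length xs}"
    if J: "J \<subseteq> {..<length xs}" "(\<Otimes>i\<in>J. map f xs ! i) = \<one>" for J
  proof (cases "(!) xs ` J = set xs")
    case True
    then show ?thesis
      using bij J(1) by (metis bij_betw_def inj_on_image_eq_iff order_refl)
  next
    case False
    moreover have "(!) xs ` J \<subseteq> set xs" using J(1) by auto
    ultimately show ?thesis using minimal[of "(!) xs ` J"] J prod by auto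
  qed
  then show ?thesis
    using assms(2,3) prod[of "{..<length xs}"] bij
    by (auto simp: is_atom_iff bij_betw_def)
qed

text \<open>Strong induction on \<open>A\<close>: a proper nonempty subset with trivial product
  splits \<open>A\<close> into two smaller blocks, and if there is none, an enumeration of
  \<open>A\<close> gives an atom. Indexing by \<open>A\<close> counts repeated elements with
  multiplicity and makes sub-blocks plain subsets.\<close>

lemma sum_inverse_ord_in_Ints:
  assumes whf: "weakly_half_factorial G S" and S: "S \<subseteq> carrier G - {\<one>}"
    and "finite A" "f ` A \<subseteq> S" "(\<Otimes>i\<in>A. f i) = \<one>"
  shows "(\<Sum>i\<in>A. 1 / real (ord (f i))) \<in> \<int>"
  using assms(3-)
proof (induction A rule: finite_psubset_induct)
  case (psubset A)
  have fA: "f \<in> A \<rightarrow> carrier G" using psubset.prems(1) S by auto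
  show ?case
  proof (cases "\<exists>J. J \<subset> A \<and> J \<noteq> {} \<and> (\<Otimes>i\<in>J. f i) = \<one>")
    case True
    then obtain J where J: "J \<subset> A" "J \<noteq> {}" "(\<Otimes>i\<in>J. f i) = \<one>" by blast
    have fin: "finite J" using J(1) psubset.hyps finite_subset by blast
    have A: "A = J \<union> (A - J)" using J(1) by blast
    \<comment> \<open>The products over \<open>A\<close> and \<open>J\<close> are trivial, hence so
      is the one over \<open>A - J\<close>, which is a proper subset because \<open>J\<close> is
      nonempty.\<close>
    have "(\<Otimes>i\<in>J \<union> (A - J). f i) = (\<Otimes>i\<in>J. f i) \<otimes> (\<Otimes>i\<in>A - J. f i)"
      using J(1) fin psubset.hyps fA by (intro finprod_Un_disjoint) auto
    moreover have "(\<Otimes>i\<in>A - J. f i) \<in> carrier G" using fA by (intro finprod_closed) auto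
    ultimately have "(\<Otimes>i\<in>A - J. f i) = \<one>"
      using J(3) psubset.prems(2) A by auto
    then have "(\<Sum>i\<in>A - J. 1 / real (ord (f i))) \<in> \<int>"
      using J psubset.prems by (intro psubset.IH) auto
    moreover have "(\<Sum>i\<in>J. 1 / real (ord (f i))) \<in> \<int>"
      using J psubset.prems by (intro psubset.IH) auto
    ultimately show ?thesis
      using sum.subset_diff[of J A "\<lambda>i. 1 / real (ord (f i))"] J(1) psubset.hyps by auto
  next
    case False
    obtain xs where xs: "set xs = A" "distinct xs"
      using finite_distinct_list[OF psubset.hyps] by blast
    have "is_atom G (map f xs)"
      using xs psubset.prems S False by (intro is_atom_map) auto
    then have "cross_number G (map f xs) \<in> \<int>"
      using whf psubset.prems(1) xs(1) by (auto simp: weakly_half_factorial_def)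
    moreover have "cross_number G (map f xs) = (\<Sum>i\<in>A. 1 / real (ord (f i)))"
      using sum.reindex_bij_betw[OF bij_betw_nth[OF xs(2) refl xs(1)[symmetric]],
          of "\<lambda>i. 1 / real (ord (f i))"]
      by (simp add: cross_number_def)
    ultimately show ?thesis by simp
  qed
qed

section \<open>Walks of the Cayley digraph as lists of generators\<close>

fun cayley_walk :: "'a \<Rightarrow> 'a list \<Rightarrow> ('a \<times> 'a) list" where
  "cayley_walk u [] = []"
| "cayley_walk u (s # gs) = (u, u \<otimes> s) # cayley_walk (u \<otimes> s) gs"

lemma length_cayley_walk [simp]: "length (cayley_walk u gs) = length gs"
  by (induction gs arbitrary: u) auto

text \<open>Inductions along \<open>cayley_walk\<close> peel off the first generator, so the product
  has to be split at the front. Letting \<open>n\<close> stop short of the end covers the partial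
  products that give the intermediate vertices.\<close>

lemma finprod_nth_Cons:
  assumes "s \<in> carrier G" "set gs \<subseteq> carrier G" "n \<le> length gs"
  shows "(\<Otimes>i\<in>{..<Suc n}. (s # gs) ! i) = s \<otimes> (\<Otimes>i\<in>{..<n}. gs ! i)"
proof -
  have gs: "gs ! i \<in> carrier G" if "i < n" for i
    using that assms by (meson nth_mem order_less_le_trans subsetD)
  have "(\<Otimes>i\<in>Suc ` {..<n}. (s # gs) ! i) = (\<Otimes>i\<in>{..<n}. gs ! i)"
    using gs by (subst finprod_reindex) auto
  then show ?thesis
    unfolding lessThan_Suc_eq_insert_0 using assms(1) gs by (subst finprod_insert) auto
qed

lemma awalk_cayley_walk:
  assumes "S \<subseteq> carrier G" "u \<in> carrier G" "set gs \<subseteq> S"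
  shows "pre_digraph.awalk (cayley_digraph G S) u (cayley_walk u gs)
           (u \<otimes> (\<Otimes>i\<in>{..<length gs}. gs ! i))"
  using assms(2,3)
proof (induction gs arbitrary: u)
  case Nil
  then show ?case
    by (simp add: pre_digraph.awalk_def pre_digraph.cas.simps cayley_digraph_def)
next
  case (Cons s gs)
  have s: "s \<in> carrier G" and gs: "set gs \<subseteq> carrier G" using Cons.prems assms(1) by auto
  then have "(\<Otimes>i\<in>{..<length gs}. gs ! i) \<in> carrier G"
    using nth_mem by (intro finprod_closed) blast
  then have "u \<otimes> (\<Otimes>i\<in>{..<length (s # gs)}. (s # gs) ! i) =
      u \<otimes> s \<otimes> (\<Otimes>i\<in>{..<length gs}. gs ! i)"
    using finprod_nth_Cons[OF s gs order_refl] s Cons.prems(1) by (simp add: m_assoc)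
  with Cons.IH[of "u \<otimes> s"] Cons.prems s show ?case
    by (auto simp: pre_digraph.awalk_def pre_digraph.cas.simps cayley_digraph_def)
qed

lemma awalk_verts_cayley_walk:
  assumes "u \<in> carrier G" "set gs \<subseteq> carrier G" "n \<le> length gs"
  shows "pre_digraph.awalk_verts (cayley_digraph G S) u (cayley_walk u gs) ! n =
           u \<otimes> (\<Otimes>i\<in>{..<n}. gs ! i)"
  using assms
proof (induction gs arbitrary: u n)
  case Nil
  then show ?case by (simp add: pre_digraph.awalk_verts.simps cayley_digraph_def)
next
  case (Cons s gs)
  show ?case
  proof (cases n)
    case 0
    with Cons.prems show ?thesis
      by (simp add: pre_digraph.awalk_verts.simps cayley_digraph_def)
  next
    case (Suc k)
    have "(\<Otimes>i\<in>{..<k}. gs ! i) \<in> carrier G"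
      using Cons.prems Suc by (intro finprod_closed) (auto simp: subset_iff)
    then show ?thesis
      using Cons.IH[of "u \<otimes> s" k] Cons.prems Suc finprod_nth_Cons[of s gs k]
      by (simp add: pre_digraph.awalk_verts.simps cayley_digraph_def m_assoc)
  qed
qed

text \<open>Every arc leaving \<open>u\<close> has the form \<open>(u, u \<otimes> s)\<close> with
  \<open>s\<close> in \<open>S\<close>, so the generators can be read off one arc at a time.\<close>

lemma awalk_cayley_digraph:
  assumes "S \<subseteq> carrier G" "pre_digraph.awalk (cayley_digraph G S) u p v"
  obtains gs where "set gs \<subseteq> S" "p = cayley_walk u gs" "v = u \<otimes> (\<Otimes>i\<in>{..<length gs}. gs ! i)"
proof -
  \<comment> \<open>Start vertex and arcs determine the end vertex; this identifies \<open>v\<close>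
    with the end that \<open>awalk_cayley_walk\<close> computes.\<close>
  have cas_end: "pre_digraph.cas D u p v \<Longrightarrow> pre_digraph.cas D u p w \<Longrightarrow> v = w"
    for D :: "('a, 'a \<times> 'a) pre_digraph" and u v w p
    by (induction p arbitrary: u) (auto simp: pre_digraph.cas.simps)
  have "\<exists>gs. set gs \<subseteq> S \<and> p = cayley_walk u gs"
    using assms(2)
  proof (induction p arbitrary: u)
    case Nil
    show ?case by (rule exI[of _ "[]"]) simp
  next
    case (Cons a p)
    then obtain s where s: "s \<in> S" "a = (u, u \<otimes> s)" "u \<in> carrier G"
      by (auto simp: pre_digraph.awalk_def pre_digraph.cas.simps cayley_digraph_def)
    with Cons.prems assms(1) have "pre_digraph.awalk (cayley_digraph G S) (u \<otimes> s) p v"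
      by (auto simp: pre_digraph.awalk_def pre_digraph.cas.simps cayley_digraph_def)
    from Cons.IH[OF this] obtain gs where "set gs \<subseteq> S" "p = cayley_walk (u \<otimes> s) gs" by blast
    with s show ?case by (intro exI[of _ "s # gs"]) simp
  qed
  then obtain gs where gs: "set gs \<subseteq> S" "p = cayley_walk u gs" by blast
  have "u \<in> carrier G"
    using assms(2) by (simp add: pre_digraph.awalk_def cayley_digraph_def)
  from awalk_cayley_walk[OF assms(1) this gs(1)] assms(2) gs(2)
  have "v = u \<otimes> (\<Otimes>i\<in>{..<length gs}. gs ! i)"
    by (auto simp: pre_digraph.awalk_def intro: cas_end)
  with gs that show thesis by blast
qed

section \<open>Voltages and cross numbers\<close>

lemma voltage_cayley_walk:
  assumes "u \<in> carrier G" "set gs \<subseteq> carrier G"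
  shows "foldr (*) (map (cayley_voltage G) (cayley_walk u gs)) 1 =
           exp (2 * of_real pi * \<i> * of_real (cross_number G gs))"
  using assms
proof (induction gs arbitrary: u)
  case Nil
  then show ?case by (simp add: cross_number_def)
next
  case (Cons s gs)
  have "cross_number G (s # gs) = 1 / real (ord s) + cross_number G gs"
    by (simp add: cross_number_def sum.lessThan_Suc_shift del: sum.lessThan_Suc)
  with Cons show ?case
    by (simp add: cayley_voltage_arc[OF is_group] distrib_left flip: exp_add)
qed

text \<open>The link used in both directions of the theorem: \<open>exp\<close> takes the value 1
  exactly at the integer multiples of \<open>2 * pi * \<i>\<close>.\<close>

lemma voltage_cayley_walk_eq_1_iff:
  assumes "u \<in> carrier G" "set gs \<subseteq> carrier G"
  shows "foldr (*) (map (cayley_voltage G) (cayley_walk u gs)) 1 = 1 \<longleftrightarrow> cross_number G gs \<in> \<int>"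
proof -
  have "exp (2 * of_real pi * \<i> * of_real c) = 1 \<longleftrightarrow> c \<in> \<int>" for c :: real
    by (auto simp: exp_eq_1 Ints_def)
  then show ?thesis by (simp add: voltage_cayley_walk[OF assms])
qed

section \<open>Closed paths from atoms\<close>

lemma cycle_cayley_walk:
  assumes "S \<subseteq> carrier G" "is_atom G gs" "set gs \<subseteq> S" "gs \<noteq> []"
  shows "pre_digraph.cycle (cayley_digraph G S) (cayley_walk \<one> gs)"
proof -
  have carr: "set gs \<subseteq> carrier G" using assms(1,3) by blast
  then have closed: "gs ! i \<in> carrier G" if "i < length gs" for i
    using that by auto
  have walk: "pre_digraph.awalk (cayley_digraph G S) \<one> (cayley_walk \<one> gs) \<one>"
    using awalk_cayley_walk[OF assms(1) one_closed assms(3)] assms(2) by (simp add: is_atom_iff)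
  \<comment> \<open>The factor \<open>\<one>\<close> is kept so that \<open>eq\<close> has the shape
    in which \<open>awalk_verts_cayley_walk\<close> gives the vertices.\<close>
  have "i = 0 \<and> j = length gs"
    if ij: "i < j" "j \<le> length gs"
      and eq: "\<one> \<otimes> (\<Otimes>k\<in>{..<i}. gs ! k) = \<one> \<otimes> (\<Otimes>k\<in>{..<j}. gs ! k)" for i j
  proof -
    have in_carr: "(\<Otimes>k\<in>{..<i}. gs ! k) \<in> carrier G" "(\<Otimes>k\<in>{i..<j}. gs ! k) \<in> carrier G"
      using ij closed by (auto intro!: finprod_closed)
    have "{..<j} = {..<i} \<union> {i..<j}" using ij(1) by auto
    then have "(\<Otimes>k\<in>{..<j}. gs ! k) = (\<Otimes>k\<in>{..<i}. gs ! k) \<otimes> (\<Otimes>k\<in>{i..<j}. gs ! k)"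
      using ij closed by (simp only:) (intro finprod_Un_disjoint, auto)
    with eq in_carr have "(\<Otimes>k\<in>{i..<j}. gs ! k) = \<one>"
      by (metis l_cancel_one l_one m_closed)
    moreover have "{i..<j} \<subseteq> {..<length gs}" using ij(2) by auto
    \<comment> \<open>Since \<open>i < j\<close>, the interval is nonempty, and minimality leaves
      only the full index set.\<close>
    ultimately have "{i..<j} = {..<length gs}"
      using assms(2) ij(1) unfolding is_atom_iff by (metis atLeastLessThan_empty_iff)
    with ij assms(4) show ?thesis by (auto simp: lessThan_atLeast0 atLeastLessThan_eq_iff)
  qed
  then have "\<forall>i j. i < j \<and> j \<le> length (cayley_walk \<one> gs) \<and>
        pre_digraph.awalk_verts (cayley_digraph G S) \<one> (cayley_walk \<one> gs) ! i =
        pre_digraph.awalk_verts (cayley_digraph G S) \<one> (cayley_walk \<one> gs) ! j \<longrightarrow>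
        i = 0 \<and> j = length (cayley_walk \<one> gs)"
    using awalk_verts_cayley_walk[OF one_closed carr] by auto
  moreover have "cayley_walk \<one> gs \<noteq> []" using assms(4) by (cases gs) auto
  ultimately show ?thesis using walk unfolding cycle_iff_closed_path by blast
qed

end

theorem theorem2:
  fixes G :: "('a, 'b) monoid_scheme" and S :: "'a set"
  assumes "comm_group G"
    and "finite (carrier G)"
    and "S \<subseteq> carrier G - {\<one>\<^bsub>G\<^esub>}"
  shows "weakly_half_factorial G S \<longleftrightarrow>
    kirchhoff_voltage_law (cayley_digraph G S) (cayley_voltage G)
      (roots_of_unity_group (group_exponent G))"
proof -
  interpret comm_group G by fact
  have S: "S \<subseteq> carrier G" using assms(3) by blast
  \<comment> \<open>Unfolding the group of roots of unity leaves complex multiplication and 1, the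
    form of the voltage lemmas.\<close>
  have kvl: "kirchhoff_voltage_law (cayley_digraph G S) (cayley_voltage G)
      (roots_of_unity_group (group_exponent G)) \<longleftrightarrow>
    (\<forall>p. pre_digraph.cycle (cayley_digraph G S) p \<longrightarrow>
      foldr (*) (map (cayley_voltage G) p) 1 = 1)"
    by (simp add: kirchhoff_voltage_law_def roots_of_unity_group_def)
  show ?thesis
    unfolding kvl
  proof (intro iffI allI impI)
    fix p
    assume whf: "weakly_half_factorial G S" and "pre_digraph.cycle (cayley_digraph G S) p"
    then obtain u where walk: "pre_digraph.awalk (cayley_digraph G S) u p u"
      by (auto simp: pre_digraph.cycle_def)
    then obtain gs where gs: "set gs \<subseteq> S" "p = cayley_walk u gs"
      and closed: "u = u \<otimes>\<^bsub>G\<^esub> (\<Otimes>\<^bsub>G\<^esub>i\<in>{..<length gs}. gs ! i)"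
      using awalk_cayley_digraph[OF S] by metis
    have u: "u \<in> carrier G"
      using walk by (simp add: pre_digraph.awalk_def cayley_digraph_def)
    have "(\<Otimes>\<^bsub>G\<^esub>i\<in>{..<length gs}. gs ! i) \<in> carrier G"
      using gs(1) S by (intro finprod_closed) (auto simp: subset_iff)
    \<comment> \<open>The walk may start anywhere; its start vertex cancels.\<close>
    with closed u have "(\<Otimes>\<^bsub>G\<^esub>i\<in>{..<length gs}. gs ! i) = \<one>\<^bsub>G\<^esub>"
      by (metis l_cancel_one)
    then have "cross_number G gs \<in> \<int>"
      unfolding cross_number_def using gs(1)
      by (intro sum_inverse_ord_in_Ints[OF whf assms(3)]) auto
    then show "foldr (*) (map (cayley_voltage G) p) 1 = 1"
      using voltage_cayley_walk_eq_1_iff[OF u] gs S by auto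
  next
    assume kvl: "\<forall>p. pre_digraph.cycle (cayley_digraph G S) p \<longrightarrow>
      foldr (*) (map (cayley_voltage G) p) 1 = 1"
    have "cross_number G gs \<in> \<int>" if gs: "is_atom G gs" "set gs \<subseteq> S" for gs
    proof (cases "gs = []")
      \<comment> \<open>The empty list is an atom but yields no closed path, which has at least one
        arc; its cross number is 0.\<close>
      case True
      then show ?thesis by (simp add: cross_number_def)
    next
      case False
      then have "foldr (*) (map (cayley_voltage G) (cayley_walk \<one>\<^bsub>G\<^esub> gs)) 1 = 1"
        using kvl cycle_cayley_walk[OF S gs] by blast
      then show ?thesis
        using voltage_cayley_walk_eq_1_iff[OF one_closed, of gs] gs(2) S by blast
    qed
    then show "weakly_half_factorial G S"
      by (auto simp: weakly_half_factorial_def)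
  qed
qed

end
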